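(* If $G$ is a Left dead end with a good option that is prime-factorisable, then $n\cdot G$ is uniquely factorisable for every integer $n\geq0$.
   Context: All games are short partizan combinatorial game forms; $G+H$ is the disjunctive sum and $n\cdot G$ is the sum of $n$ copies of $G$ ($0\cdot G=0=\{\cdot\mid\cdot\}$). Play is misère (a player unable to move wins). Misère outcome classes are ordered $\mathscr L>\mathscr P>\mathscr R$ and $\mathscr L>\mathscr N>\mathscr R$; $G\geq H$ means that for every game $X$ the misère outcome of $G+X$ is $\geq$ that of $H+X$, $G=H$ means $G\ge H$ and $H\ge G$, and $G>H$ means $G\ge H$ and $G\ne H$. A Left dead end is a game no subposition of which (including itself) has a Left option; its options are its Right options. An option $G'$ of $G$ is good if there is no option $G''$ of $G$ with $G'>G''$. The Left dead ends up to equality form a commutative monoid under $+$ with identity $0$. An atom is a Left dead end $A\neq0$ such that $A=X+Y$ with Left dead ends $X,Y$ implies $X=0$ or $Y=0$. A factorisation of $G$ is an expression $G=A_1+\dots+A_k$ ($k\ge0$) with atoms $A_i$, up to reordering and replacing atoms by equal ones; $G$ is uniquely factorisable if it has exactly one factorisation. $P\mid X$ means $X=P+Y$ for some Left dead end $Y$; a prime is a Left dead end $P\neq0$ such that $P\mid X+Y$ implies $P\mid X$ or $P\mid Y$; prime-factorisable means having a factorisation consisting only of primes (the empty sum included). *)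

theory Defs
  imports Main "HOL-Library.FSet" "HOL-Library.Multiset"
begin

section \<open>Short partizan game forms\<close>

datatype game = Game (left_opts: "game fset") (right_opts: "game fset")

definition is_option :: "game \<Rightarrow> game \<Rightarrow> bool" where
  "is_option H G \<longleftrightarrow> H |\<in>| left_opts G \<or> H |\<in>| right_opts G"

definition subposition :: "game \<Rightarrow> game \<Rightarrow> bool" where
  "subposition = is_option\<^sup>*\<^sup>*"

lemma size_mem_fset: "H |\<in>| X \<Longrightarrow> size H < size_fset size X"
  by (simp add: size_fset_overloaded_def sum.remove[of "fset X" H])

lemma size_left_opts [termination_simp]: "H |\<in>| left_opts G \<Longrightarrow> size H < size G"
  by (cases G) (auto dest: size_mem_fset)

lemma size_right_opts [termination_simp]: "H |\<in>| right_opts G \<Longrightarrow> size H < size G"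
  by (cases G) (auto dest: size_mem_fset)

section \<open>Disjunctive sum\<close>

text \<open>Forms are finite sets of forms, so the monoid laws hold already as identities of forms;
  equality of games in the sense of misere play is \<open>game_eq\<close> below, not \<open>(=)\<close>.\<close>

instantiation game :: comm_monoid_add
begin

definition zero_game :: game where
  "0 = Game {||} {||}"

function plus_game :: "game \<Rightarrow> game \<Rightarrow> game" where
  "G + H = Game
     (((\<lambda>G'. G' + H) |`| left_opts G) |\<union>| ((\<lambda>H'. G + H') |`| left_opts H))
     (((\<lambda>G'. G' + H) |`| right_opts G) |\<union>| ((\<lambda>H'. G + H') |`| right_opts H))"
  by pat_completeness auto
termination
  by (relation "measure (\<lambda>(G, H). size G + size H)") (auto dest: size_left_opts size_right_opts)

declare plus_game.simps [simp del]

lemma left_opts_plus: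
  "left_opts (G + H) =
     ((\<lambda>G'. G' + H) |`| left_opts G) |\<union>| ((\<lambda>H'. G + H') |`| left_opts H)"
  by (subst plus_game.simps) simp

lemma right_opts_plus:
  "right_opts (G + H) =
     ((\<lambda>G'. G' + H) |`| right_opts G) |\<union>| ((\<lambda>H'. G + H') |`| right_opts H)"
  by (subst plus_game.simps) simp

instance
proof
  fix G H K :: game
  show "G + H + K = G + (H + K)"
  proof (induction "size G + size H + size K" arbitrary: G H K rule: less_induct)
    case less
    have "(\<lambda>G'. G' + H + K) |`| F G = (\<lambda>G'. G' + (H + K)) |`| F G"
         "(\<lambda>H'. G + H' + K) |`| F H = (\<lambda>H'. G + (H' + K)) |`| F H"
         "(\<lambda>K'. G + H + K') |`| F K = (\<lambda>K'. G + (H + K')) |`| F K"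
      if "F = left_opts \<or> F = right_opts" for F
      using that
      by (auto intro!: fset.map_cong0 less dest: size_left_opts size_right_opts)
    then show ?case
      by (simp add: plus_game.simps[of "G + H" K] plus_game.simps[of G "H + K"] left_opts_plus
          right_opts_plus fimage_funion comp_def funion_assoc)
  qed
  show "G + H = H + G"
  proof (induction "size G + size H" arbitrary: G H rule: less_induct)
    case less
    have "(\<lambda>G'. G' + H) |`| F G = (\<lambda>G'. H + G') |`| F G"
         "(\<lambda>H'. G + H') |`| F H = (\<lambda>H'. H' + G) |`| F H"
      if "F = left_opts \<or> F = right_opts" for F
      using that
      by (auto intro!: fset.map_cong0 less dest: size_left_opts size_right_opts)
    then show ?case
      by (simp add: plus_game.simps[of G H] plus_game.simps[of H G] funion_commute)
  qed
  show "0 + G = G"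
  proof (induction "size G" arbitrary: G rule: less_induct)
    case less
    have "(+) 0 |`| F G = id |`| F G" if "F = left_opts \<or> F = right_opts" for F
    proof (rule fset.map_cong0)
      show "0 + G' = id G'" if "G' \<in> fset (F G)" for G'
        using that \<open>F = left_opts \<or> F = right_opts\<close>
        by (auto intro!: less dest: size_left_opts size_right_opts)
    qed
    then show ?case
      by (simp add: plus_game.simps[of 0 G]) (simp add: zero_game_def)
  qed
qed

end

primrec copies :: "nat \<Rightarrow> game \<Rightarrow> game" where
  "copies 0 G = 0"
| "copies (Suc n) G = G + copies n G"

section \<open>Misere play\<close>

text \<open>\<open>left_wins_first G\<close>: Left wins \<open>G\<close> under misere play when she moves first;
  similarly for Right.\<close>

function left_wins_first :: "game \<Rightarrow> bool" and right_wins_first :: "game \<Rightarrow> bool" where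
  "left_wins_first G \<longleftrightarrow>
     left_opts G = {||} \<or> (\<exists>G'|\<in>|left_opts G. \<not> right_wins_first G')"
| "right_wins_first G \<longleftrightarrow>
     right_opts G = {||} \<or> (\<exists>G'|\<in>|right_opts G. \<not> left_wins_first G')"
  by pat_completeness auto
termination
  by (relation "measure (case_sum size size)") (auto dest: size_left_opts size_right_opts)

declare left_wins_first.simps [simp del] right_wins_first.simps [simp del]

datatype outcome = Left_wins | Previous_wins | Next_wins | Right_wins

instantiation outcome :: order
begin

definition less_eq_outcome :: "outcome \<Rightarrow> outcome \<Rightarrow> bool" where
  "x \<le> y \<longleftrightarrow> x = y \<or> x = Right_wins \<or> y = Left_wins"

definition less_outcome :: "outcome \<Rightarrow> outcome \<Rightarrow> bool" where
  "x < y \<longleftrightarrow> x \<le> y \<and> x \<noteq> (y :: outcome)"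

instance
  by standard (auto simp: less_eq_outcome_def less_outcome_def)

end

definition misere_outcome :: "game \<Rightarrow> outcome" where
  "misere_outcome G =
     (if left_wins_first G
      then (if right_wins_first G then Next_wins else Left_wins)
      else (if right_wins_first G then Right_wins else Previous_wins))"

definition game_ge :: "game \<Rightarrow> game \<Rightarrow> bool" where
  "game_ge G H \<longleftrightarrow> (\<forall>X. misere_outcome (G + X) \<ge> misere_outcome (H + X))"

definition game_eq :: "game \<Rightarrow> game \<Rightarrow> bool" where
  "game_eq G H \<longleftrightarrow> game_ge G H \<and> game_ge H G"

definition game_gt :: "game \<Rightarrow> game \<Rightarrow> bool" where
  "game_gt G H \<longleftrightarrow> game_ge G H \<and> \<not> game_eq G H"

section \<open>Left dead ends\<close>

definition left_dead_end :: "game \<Rightarrow> bool" where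
  "left_dead_end G \<longleftrightarrow> (\<forall>H. subposition H G \<longrightarrow> left_opts H = {||})"

text \<open>Intended for Left dead ends \<open>G\<close>, whose options are all Right options.\<close>

definition good_option :: "game \<Rightarrow> game \<Rightarrow> bool" where
  "good_option G' G \<longleftrightarrow>
     G' |\<in>| right_opts G \<and> \<not> (\<exists>G''|\<in>|right_opts G. game_gt G' G'')"

definition atom :: "game \<Rightarrow> bool" where
  "atom A \<longleftrightarrow> left_dead_end A \<and> \<not> game_eq A 0 \<and>
     (\<forall>X Y. left_dead_end X \<longrightarrow> left_dead_end Y \<longrightarrow> game_eq A (X + Y) \<longrightarrow>
        game_eq X 0 \<or> game_eq Y 0)"

definition divides :: "game \<Rightarrow> game \<Rightarrow> bool" where
  "divides P X \<longleftrightarrow> (\<exists>Y. left_dead_end Y \<and> game_eq X (P + Y))"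

definition prime_dead_end :: "game \<Rightarrow> bool" where
  "prime_dead_end P \<longleftrightarrow> left_dead_end P \<and> \<not> game_eq P 0 \<and>
     (\<forall>X Y. left_dead_end X \<longrightarrow> left_dead_end Y \<longrightarrow> divides P (X + Y) \<longrightarrow>
        divides P X \<or> divides P Y)"

definition factorisation :: "game multiset \<Rightarrow> game \<Rightarrow> bool" where
  "factorisation M G \<longleftrightarrow> (\<forall>A\<in>#M. atom A) \<and> game_eq G (\<Sum>\<^sub># M)"

definition prime_factorisable :: "game \<Rightarrow> bool" where
  "prime_factorisable G \<longleftrightarrow> (\<exists>M. factorisation M G \<and> (\<forall>P\<in>#M. prime_dead_end P))"

text \<open>\<open>rel_mset game_eq\<close> identifies factorisations that differ only by replacing atoms
  by equal ones.\<close>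

definition uniquely_factorisable :: "game \<Rightarrow> bool" where
  "uniquely_factorisable G \<longleftrightarrow>
     (\<exists>M. factorisation M G) \<and>
     (\<forall>M N. factorisation M G \<longrightarrow> factorisation N G \<longrightarrow> rel_mset game_eq M N)"

end

(* On Left dead ends the order is computed recursively: G >= H iff every option of G lies above
   some option of H, and G, H are both zero or both nonzero. This makes the monoid cancellative.
   By cancellation primes can be removed from any two factorisations, and a good option of X + Y
   equals X' + Y or X + Y' for an option X' of X or Y' of Y. Hence a prime-factorisable good
   option forces G = A + primes, where the atom A has a good option A' that is a sum of primes.
   For n A, induct on n: a factorisation B_1 + ... + B_k of (n+1) A gives, say,
   A' + n A = B_1' + B_2 + ... + B_k, whose factorisation is unique, so each of B_2, ..., B_k is A
   or a prime; such a prime divides (n+1) A, hence equals A. Cancelling leaves B_1 = A. *)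
theory Submission
  imports Defs
begin

abbreviation game_eq_infix :: "game \<Rightarrow> game \<Rightarrow> bool" (infix "\<approx>" 50) where
  "G \<approx> H \<equiv> game_eq G H"

section \<open>The order on Left dead ends\<close>

lemma misere_outcome_ge_iff:
  "misere_outcome G \<ge> misere_outcome H \<longleftrightarrow>
     (left_wins_first H \<longrightarrow> left_wins_first G) \<and> (right_wins_first G \<longrightarrow> right_wins_first H)"
  by (auto simp: misere_outcome_def less_eq_outcome_def)

lemma game_ge_refl [simp]: "game_ge G G"
  by (simp add: game_ge_def)

lemma game_ge_trans [trans]: "game_ge G H \<Longrightarrow> game_ge H K \<Longrightarrow> game_ge G K"
  unfolding game_ge_def by (meson order_trans)

lemma game_ge_add_right: "game_ge G H \<Longrightarrow> game_ge (G + K) (H + K)"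
  unfolding game_ge_def by (simp add: add.assoc)

lemma game_eq_refl [simp]: "G \<approx> G"
  by (simp add: game_eq_def)

lemma game_eq_sym: "G \<approx> H \<Longrightarrow> H \<approx> G"
  by (simp add: game_eq_def)

lemma game_eq_trans [trans]: "G \<approx> H \<Longrightarrow> H \<approx> K \<Longrightarrow> G \<approx> K"
  unfolding game_eq_def by (meson game_ge_trans)

lemma game_eq_add_right: "G \<approx> H \<Longrightarrow> G + K \<approx> H + K"
  by (simp add: game_eq_def game_ge_add_right)

lemma game_eq_add: "G \<approx> H \<Longrightarrow> J \<approx> K \<Longrightarrow> G + J \<approx> H + K"
  by (metis add.commute game_eq_add_right game_eq_trans)

lemma zero_opts [simp]: "left_opts 0 = {||}" "right_opts 0 = {||}"
  by (simp_all add: zero_game_def)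

section \<open>Closure of Left dead ends under options and sums\<close>

lemma left_dead_end_left_opts: "left_dead_end G \<Longrightarrow> left_opts G = {||}"
  by (simp add: left_dead_end_def subposition_def)

lemma left_dead_end_option: "left_dead_end G \<Longrightarrow> G' |\<in>| right_opts G \<Longrightarrow> left_dead_end G'"
  unfolding left_dead_end_def subposition_def
  by (meson is_option_def rtranclp.rtrancl_into_rtrancl)

lemma left_dead_endI:
  assumes "left_opts G = {||}" and "\<And>G'. G' |\<in>| right_opts G \<Longrightarrow> left_dead_end G'"
  shows "left_dead_end G"
  unfolding left_dead_end_def
proof (intro allI impI)
  fix H assume "subposition H G"
  then show "left_opts H = {||}"
    unfolding subposition_def
    by (cases rule: rtranclp.cases)
      (use assms in \<open>auto simp: is_option_def left_dead_end_def subposition_def\<close>)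
qed

lemma left_dead_end_0 [simp]: "left_dead_end 0"
  by (rule left_dead_endI) auto

lemma left_dead_end_add: "left_dead_end G \<Longrightarrow> left_dead_end H \<Longrightarrow> left_dead_end (G + H)"
proof (induction "size G + size H" arbitrary: G H rule: less_induct)
  case less
  show ?case
  proof (rule left_dead_endI)
    show "left_opts (G + H) = {||}"
      using less.prems by (simp add: left_opts_plus left_dead_end_left_opts)
    show "left_dead_end K" if "K |\<in>| right_opts (G + H)" for K
      using that less.prems
      by (auto simp: right_opts_plus intro!: less.hyps dest: left_dead_end_option size_right_opts)
  qed
qed

lemma left_dead_end_sum_mset: "(\<And>A. A \<in># M \<Longrightarrow> left_dead_end A) \<Longrightarrow> left_dead_end (\<Sum>\<^sub># M)"
  by (induction M) (auto intro: left_dead_end_add)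

lemma right_opts_empty_iff: "left_dead_end G \<Longrightarrow> right_opts G = {||} \<longleftrightarrow> G = 0"
  by (cases G) (auto simp: zero_game_def dest: left_dead_end_left_opts)

lemma right_opts_plus_empty_iff:
  "right_opts (G + H) = {||} \<longleftrightarrow> right_opts G = {||} \<and> right_opts H = {||}"
  by (auto simp: right_opts_plus)

section \<open>Test games separating Left dead ends\<close>

lemma left_opts_dead_end_plus:
  "left_dead_end G \<Longrightarrow> left_opts (G + H) = (\<lambda>H'. G + H') |`| left_opts H"
  by (simp add: left_opts_plus left_dead_end_left_opts)

text \<open>The nonnegative integers as games: \<open>n\<close> spare moves for Left and none for
  Right. They keep Left from running out of moves, which would win for her.\<close>

fun left_int :: "nat \<Rightarrow> game" where
  "left_int 0 = 0"
| "left_int (Suc n) = Game {|left_int n|} {||}"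

lemma right_opts_left_int [simp]: "right_opts (left_int n) = {||}"
  by (cases n) auto

text \<open>Right keeps moving in \<open>G\<close>. Left can only use up the integer, and as options
  of \<open>G\<close> shrink in size, Right is out of moves no later than Left.\<close>

lemma right_wins_first_plus_left_int:
  "left_dead_end G \<Longrightarrow> size G \<le> n \<Longrightarrow> right_wins_first (G + left_int n)"
proof (induction n arbitrary: G)
  case 0
  then have "right_opts G = {||}"
    using size_right_opts by fastforce
  then show ?case
    by (subst right_wins_first.simps) (simp add: right_opts_plus)
next
  case (Suc n)
  show ?case
  proof (cases "right_opts G = {||}")
    case True
    then show ?thesis
      by (subst right_wins_first.simps) (simp add: right_opts_plus del: left_int.simps)
  next
    case False
    then obtain G' where G': "G' |\<in>| right_opts G"
      by blast
    then have dead: "left_dead_end G'" and "size G' \<le> n"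
      using Suc.prems left_dead_end_option size_right_opts by fastforce+
    then have "right_wins_first (G' + left_int n)"
      by (rule Suc.IH)
    then have "\<not> left_wins_first (G' + left_int (Suc n))"
      by (subst left_wins_first.simps) (simp add: left_opts_dead_end_plus dead)
    then show ?thesis
      using G' by (subst right_wins_first.simps) (auto simp: right_opts_plus)
  qed
qed

lemma game_ge_iff_wins:
  "game_ge G H \<longleftrightarrow>
     (\<forall>X. (left_wins_first (H + X) \<longrightarrow> left_wins_first (G + X)) \<and>
          (right_wins_first (G + X) \<longrightarrow> right_wins_first (H + X)))"
  by (simp add: game_ge_def misere_outcome_ge_iff)

lemma left_wins_first_dead_end: "left_dead_end G \<Longrightarrow> left_wins_first G"
  by (subst left_wins_first.simps) (simp add: left_dead_end_left_opts)

text \<open>A single spare move for Right. Left wins by moving to it next to a dead end: Right is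
  then forced to move, and Left has no move in whatever he leaves.\<close>

abbreviation (input) minus_one :: game where
  "minus_one \<equiv> Game {||} {|0|}"

lemma left_dead_end_minus_one: "left_dead_end minus_one"
  by (rule left_dead_endI) auto

lemma not_right_wins_first_plus_minus_one:
  assumes "left_dead_end G"
  shows "\<not> right_wins_first (G + minus_one)"
proof -
  have "left_dead_end (G + minus_one)"
    using assms left_dead_end_add left_dead_end_minus_one by blast
  moreover have "right_opts (G + minus_one) \<noteq> {||}"
    by (simp add: right_opts_plus)
  ultimately show ?thesis
    by (subst right_wins_first.simps) (auto dest: left_dead_end_option left_wins_first_dead_end)
qed

lemma left_wins_first_if_minus_one:
  assumes "left_dead_end G" "minus_one |\<in>| left_opts X"
  shows "left_wins_first (G + X)"
  using assms not_right_wins_first_plus_minus_one[OF assms(1)]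
  by (subst left_wins_first.simps) (auto simp: left_opts_dead_end_plus)

text \<open>Makes every failure of \<open>game_ge\<close> visible with Right to move. In
  \<open>game_ge_option\<close> the test games are positions reached by a move of Left, so Right
  starts there.\<close>

lemma not_game_ge_right_witness:
  assumes "left_dead_end G" "left_dead_end H" "\<not> game_ge G H"
  obtains Y where "right_wins_first (G + Y)" "\<not> right_wins_first (H + Y)"
proof -
  from assms(3) obtain X where
    X: "(left_wins_first (H + X) \<and> \<not> left_wins_first (G + X)) \<or>
        (right_wins_first (G + X) \<and> \<not> right_wins_first (H + X))"
    unfolding game_ge_iff_wins by blast
  show thesis
  proof (cases "right_wins_first (G + X) \<and> \<not> right_wins_first (H + X)")
    case True
    then show thesis
      using that by blast
  next
    case False
    with X have left: "left_wins_first (H + X)" "\<not> left_wins_first (G + X)"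
      by auto
    \<comment> \<open>Right's move to \<open>X\<close> restores the given difference with Left to
      move. The option \<open>minus_one\<close> lets Left punish any move of Right inside
      \<open>H\<close>.\<close>
    let ?Y = "Game {|minus_one|} {|X|}"
    have "right_wins_first (G + ?Y)"
      using left by (subst right_wins_first.simps) (auto simp: right_opts_plus)
    moreover have "left_wins_first (H' + ?Y)" if "H' |\<in>| right_opts H" for H'
      using that assms(2) by (intro left_wins_first_if_minus_one) (auto dest: left_dead_end_option)
    then have "\<not> right_wins_first (H + ?Y)"
      using left by (subst right_wins_first.simps) (auto simp: right_opts_plus)
    ultimately show thesis
      using that by blast
  qed
qed

text \<open>In the test game Right has no move next to \<open>0\<close> and wins at once. Next to a
  nonzero \<open>H\<close> he must move, and Left wins by replying with
  \<open>minus_one\<close>.\<close>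

lemma game_ge_zero_left:
  assumes "left_dead_end H" "game_ge 0 H"
  shows "H = 0"
proof (rule ccontr)
  assume "H \<noteq> 0"
  let ?X = "Game {|minus_one|} {||}"
  have "right_wins_first (0 + ?X)"
    by (subst right_wins_first.simps) (simp add: right_opts_plus)
  moreover have "left_wins_first (H' + ?X)" if "H' |\<in>| right_opts H" for H'
    using that assms(1) by (intro left_wins_first_if_minus_one) (auto dest: left_dead_end_option)
  then have "\<not> right_wins_first (H + ?X)"
    using \<open>H \<noteq> 0\<close> assms(1)
    by (subst right_wins_first.simps) (auto simp: right_opts_plus right_opts_empty_iff)
  ultimately show False
    using assms(2) game_ge_iff_wins by blast
qed

lemma game_ge_option:
  assumes G: "left_dead_end G" and H: "left_dead_end H"
    and ge: "game_ge G H" and G': "G' |\<in>| right_opts G"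
  shows "\<exists>H'|\<in>|right_opts H. game_ge G' H'"
proof (rule ccontr)
  assume none: "\<not> (\<exists>H'|\<in>|right_opts H. game_ge G' H')"
  have dead: "left_dead_end G'" "\<And>H'. H' |\<in>| right_opts H \<Longrightarrow> left_dead_end H'"
    using G H G' left_dead_end_option by blast+
  have "\<forall>H'\<in>fset (right_opts H). \<exists>Y. right_wins_first (G' + Y) \<and> \<not> right_wins_first (H' + Y)"
    using none dead not_game_ge_right_witness by metis
  then obtain Y where Y: "\<And>H'. H' |\<in>| right_opts H \<Longrightarrow>
      right_wins_first (G' + Y H') \<and> \<not> right_wins_first (H' + Y H')"
    by metis
  \<comment> \<open>Right wins \<open>G + X\<close> by moving to \<open>G' + X\<close>, but loses \<open>H + X\<close>: Left answers a move to
    \<open>H'\<close> with \<open>Y H'\<close>. The integer only keeps Left from being out of moves in \<open>G' + X\<close>, and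
    the option \<open>0\<close> keeps Right from being out of moves in \<open>H + X\<close>.\<close>
  define X where "X = Game (finsert (left_int (size G')) (Y |`| right_opts H)) {|0|}"
  have "right_wins_first (G' + left_int (size G'))"
    using dead(1) right_wins_first_plus_left_int by blast
  then have "\<not> left_wins_first (G' + X)"
    using Y by (subst left_wins_first.simps) (auto simp: X_def left_opts_dead_end_plus dead(1))
  then have "right_wins_first (G + X)"
    using G' by (subst right_wins_first.simps) (auto simp: right_opts_plus)
  moreover have "left_wins_first (H' + X)" if "H' |\<in>| right_opts H" for H'
    using Y[OF that] that dead(2)[OF that]
    by (subst left_wins_first.simps) (auto simp: X_def left_opts_dead_end_plus)
  then have "\<not> right_wins_first (H + X)"
    using left_wins_first_dead_end[OF H]
    by (subst right_wins_first.simps) (auto simp: right_opts_plus X_def)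
  ultimately show False
    using ge game_ge_iff_wins by blast
qed

text \<open>Converse of \<open>game_ge_zero_left\<close> and \<open>game_ge_option\<close>, by
  strategy copying with induction on the context. Left's moves all lie in \<open>X\<close> and are
  repeated; a move of Right to \<open>G'\<close> is replaced by one to a smaller \<open>H'\<close>.
  The hypothesis \<open>zero\<close> covers a win of Right through having no move.\<close>

lemma game_geI:
  assumes G: "left_dead_end G" and H: "left_dead_end H"
    and zero: "G = 0 \<Longrightarrow> H = 0"
    and opt: "\<And>G'. G' |\<in>| right_opts G \<Longrightarrow> \<exists>H'|\<in>|right_opts H. game_ge G' H'"
  shows "game_ge G H"
proof -
  have "(left_wins_first (H + X) \<longrightarrow> left_wins_first (G + X)) \<and>
        (right_wins_first (G + X) \<longrightarrow> right_wins_first (H + X))" for X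
  proof (induction "size X" arbitrary: X rule: less_induct)
    case less
    have "left_wins_first (G + X)" if "left_wins_first (H + X)"
    proof -
      have "left_opts X = {||} \<or> (\<exists>X'|\<in>|left_opts X. \<not> right_wins_first (H + X'))"
        using that by (subst (asm) left_wins_first.simps) (auto simp: left_opts_dead_end_plus H)
      then have "left_opts X = {||} \<or> (\<exists>X'|\<in>|left_opts X. \<not> right_wins_first (G + X'))"
        using less[OF size_left_opts] by blast
      then show ?thesis
        by (subst left_wins_first.simps) (auto simp: left_opts_dead_end_plus G)
    qed
    moreover have "right_wins_first (H + X)" if win: "right_wins_first (G + X)"
    proof (cases "right_opts (G + X) = {||}")
      case True
      then show ?thesis
        using zero G
        by (subst right_wins_first.simps)
          (auto simp: right_opts_plus_empty_iff right_opts_empty_iff)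
    next
      case False
      with win obtain K where K: "K |\<in>| right_opts (G + X)" "\<not> left_wins_first K"
        by (subst (asm) right_wins_first.simps) auto
      have "\<exists>J|\<in>|right_opts (H + X). \<not> left_wins_first J"
        using K opt less[OF size_right_opts]
        by (fastforce simp: right_opts_plus game_ge_iff_wins)
      then show ?thesis
        by (subst right_wins_first.simps) simp
    qed
    ultimately show ?case
      by blast
  qed
  then show ?thesis
    by (simp add: game_ge_iff_wins)
qed

lemma game_eq_zero_iff: "left_dead_end G \<Longrightarrow> G \<approx> 0 \<longleftrightarrow> G = 0"
  using game_ge_zero_left by (auto simp: game_eq_def)

section \<open>Cancellation\<close>

fun has_run :: "nat \<Rightarrow> game \<Rightarrow> bool" where
  "has_run 0 G \<longleftrightarrow> right_opts G = {||}"
| "has_run (Suc k) G \<longleftrightarrow> (\<exists>G'|\<in>|right_opts G. has_run k G')"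

text \<open>Unlike \<open>size\<close>, this measure is invariant under \<open>game_eq\<close> on
  Left dead ends. Being additive as well, it supports inductions up to equality.\<close>

definition run_length :: "game \<Rightarrow> nat" where
  "run_length G = (LEAST k. has_run k G)"

lemma has_run_exists: "\<exists>k. has_run k G"
proof (induction "size G" arbitrary: G rule: less_induct)
  case less
  show ?case
  proof (cases "right_opts G = {||}")
    case True
    then have "has_run 0 G"
      by simp
    then show ?thesis ..
  next
    case False
    then obtain G' where G': "G' |\<in>| right_opts G"
      by blast
    then obtain k where "has_run k G'"
      using less size_right_opts by blast
    then have "has_run (Suc k) G"
      using G' by auto
    then show ?thesis ..
  qed
qed

lemma has_run_run_length: "has_run (run_length G) G"
  unfolding run_length_def using has_run_exists LeastI_ex by metis

lemma run_length_le: "has_run k G \<Longrightarrow> run_length G \<le> k"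
  unfolding run_length_def by (rule Least_le)

lemma has_run_add: "has_run i G \<Longrightarrow> has_run j H \<Longrightarrow> has_run (i + j) (G + H)"
proof (induction i arbitrary: G)
  case 0
  then show ?case
    by (induction j arbitrary: H) (auto simp: right_opts_plus)
next
  case (Suc i)
  then show ?case
    by (auto simp: right_opts_plus)
qed

text \<open>A run in a sum interleaves a run in each summand; its first move decides which of the
  two counts goes up.\<close>

lemma has_run_addD:
  "has_run k (G + H) \<Longrightarrow> \<exists>i j. k = i + j \<and> has_run i G \<and> has_run j H"
proof (induction k arbitrary: G H)
  case 0
  then show ?case
    by (simp add: right_opts_plus_empty_iff)
next
  case (Suc k)
  then obtain K where K: "K |\<in>| right_opts (G + H)" "has_run k K"
    by auto
  then consider G' where "G' |\<in>| right_opts G" "K = G' + H"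
    | H' where "H' |\<in>| right_opts H" "K = G + H'"
    by (auto simp: right_opts_plus)
  then show ?case
  proof cases
    case 1
    then obtain i j where "k = i + j" "has_run i G'" "has_run j H"
      using K Suc.IH by blast
    then have "Suc k = Suc i + j \<and> has_run (Suc i) G \<and> has_run j H"
      using 1 by auto
    then show ?thesis by blast
  next
    case 2
    then obtain i j where "k = i + j" "has_run i G" "has_run j H'"
      using K Suc.IH by blast
    then have "Suc k = i + Suc j \<and> has_run i G \<and> has_run (Suc j) H"
      using 2 by auto
    then show ?thesis by blast
  qed
qed

lemma run_length_add: "run_length (G + H) = run_length G + run_length H"
proof (rule antisym)
  show "run_length (G + H) \<le> run_length G + run_length H"
    by (simp add: has_run_add has_run_run_length run_length_le)
  obtain i j where "run_length (G + H) = i + j" "has_run i G" "has_run j H"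
    using has_run_addD[OF has_run_run_length] by blast
  then show "run_length G + run_length H \<le> run_length (G + H)"
    by (simp add: add_mono run_length_le)
qed

lemma run_length_eq_0_iff: "left_dead_end G \<Longrightarrow> run_length G = 0 \<longleftrightarrow> G = 0"
  using has_run_run_length[of G] run_length_le[of 0 G] right_opts_empty_iff by fastforce

text \<open>\<open>game_ge_option\<close> matches the run in \<open>G\<close> move by move; once
  \<open>G\<close> is exhausted, \<open>game_ge_zero_left\<close> says that the position on the
  other side is as well.\<close>

lemma has_run_game_ge:
  "left_dead_end G \<Longrightarrow> left_dead_end H \<Longrightarrow> game_ge G H \<Longrightarrow> has_run k G \<Longrightarrow> has_run k H"
proof (induction k arbitrary: G H)
  case 0
  then show ?case
    using game_ge_zero_left by (auto simp: right_opts_empty_iff)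
next
  case (Suc k)
  then obtain G' where G': "G' |\<in>| right_opts G" "has_run k G'"
    by auto
  then obtain H' where "H' |\<in>| right_opts H" "game_ge G' H'"
    using game_ge_option Suc.prems by blast
  then show ?case
    using Suc G' left_dead_end_option by (metis has_run.simps(2))
qed

lemma run_length_game_ge:
  "left_dead_end G \<Longrightarrow> left_dead_end H \<Longrightarrow> game_ge G H \<Longrightarrow> run_length H \<le> run_length G"
  using has_run_game_ge has_run_run_length run_length_le by blast

lemma run_length_game_eq:
  "left_dead_end G \<Longrightarrow> left_dead_end H \<Longrightarrow> G \<approx> H \<Longrightarrow> run_length G = run_length H"
  by (simp add: antisym game_eq_def run_length_game_ge)

section \<open>Cancelling a common summand\<close>

lemma game_eq_add_zero:
  assumes "left_dead_end G" "left_dead_end H" "G + H \<approx> 0"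
  shows "G = 0"
proof -
  have "G + H = 0"
    using assms game_eq_zero_iff left_dead_end_add by blast
  then have "right_opts G = {||}"
    using right_opts_plus_empty_iff[of G H] by simp
  then show ?thesis
    using assms(1) right_opts_empty_iff by blast
qed

text \<open>If \<open>G' + K\<close> answers an option of \<open>H + K\<close> in the component \<open>K\<close>, play that move of \<open>K\<close>
  on the other side as well and repeat; \<open>K\<close> runs out eventually.\<close>

lemma game_ge_option_descend:
  assumes cancel: "\<And>H' K'. H' |\<in>| right_opts H \<Longrightarrow> left_dead_end K' \<Longrightarrow>
      game_ge (G' + K') (H' + K') \<Longrightarrow> game_ge G' H'"
    and dead: "left_dead_end G'" "left_dead_end H"
    and K: "left_dead_end K"
    and step: "\<exists>J|\<in>|right_opts (H + K). game_ge (G' + K) J"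
  shows "\<exists>H'|\<in>|right_opts H. game_ge G' H'"
  using K step
proof (induction "size K" arbitrary: K rule: less_induct)
  case less
  obtain J where J: "J |\<in>| right_opts (H + K)" "game_ge (G' + K) J"
    using less.prems by blast
  then consider H' where "H' |\<in>| right_opts H" "J = H' + K"
    | K' where "K' |\<in>| right_opts K" "J = H + K'"
    by (auto simp: right_opts_plus)
  then show ?case
  proof cases
    case 1
    then show ?thesis
      using cancel J less.prems(1) by blast
  next
    case 2
    then have K': "left_dead_end K'" "size K' < size K"
      using left_dead_end_option less.prems(1) size_right_opts by blast+
    have "G' + K' |\<in>| right_opts (G' + K)"
      using 2 by (simp add: right_opts_plus)
    then have "\<exists>I|\<in>|right_opts (H + K'). game_ge (G' + K') I"
      using game_ge_option J 2 K' dead less.prems(1) left_dead_end_add by metis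
    then show ?thesis
      using less.hyps K' by blast
  qed
qed

text \<open>Induction on \<open>G\<close> with \<open>H\<close> and \<open>K\<close> arbitrary: by
  \<open>game_geI\<close> only options must be compared, and \<open>game_ge_option_descend\<close>
  finds the answering option of \<open>H\<close> at the price of replacing \<open>K\<close> by
  smaller dead ends.\<close>

lemma game_ge_cancel:
  assumes "left_dead_end G" "left_dead_end H" "left_dead_end K" "game_ge (G + K) (H + K)"
  shows "game_ge G H"
  using assms
proof (induction "size G" arbitrary: G H K rule: less_induct)
  case less
  show ?case
  proof (rule game_geI)
    show "H = 0" if "G = 0"
    proof -
      \<comment> \<open>Additivity removes the contribution of \<open>K\<close> and leaves
        \<open>run_length H = 0\<close>.\<close>
      have "run_length (H + K) \<le> run_length (0 + K)"
        using that less.prems by (intro run_length_game_ge left_dead_end_add) auto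
      then show ?thesis
        using less.prems(2) by (simp add: run_length_add run_length_eq_0_iff)
    qed
    fix G' assume G': "G' |\<in>| right_opts G"
    then have dead: "left_dead_end G'" and smaller: "size G' < size G"
      using left_dead_end_option less.prems(1) size_right_opts by blast+
    have "G' + K |\<in>| right_opts (G + K)"
      using G' by (simp add: right_opts_plus)
    then have "\<exists>J|\<in>|right_opts (H + K). game_ge (G' + K) J"
      using game_ge_option less.prems left_dead_end_add by metis
    moreover have "game_ge G' H'"
      if "H' |\<in>| right_opts H" "left_dead_end K'" "game_ge (G' + K') (H' + K')" for H' K'
      using that less.hyps[OF smaller dead] less.prems(2) left_dead_end_option by blast
    ultimately show "\<exists>H'|\<in>|right_opts H. game_ge G' H'"
      using less.prems(2,3) dead by (metis game_ge_option_descend)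
  qed (use less.prems in auto)
qed

lemma game_eq_cancel:
  "left_dead_end G \<Longrightarrow> left_dead_end H \<Longrightarrow> left_dead_end K \<Longrightarrow> K + G \<approx> K + H \<Longrightarrow> G \<approx> H"
  unfolding game_eq_def by (metis add.commute game_ge_cancel)


lemma game_eq_cancel_self:
  "left_dead_end G \<Longrightarrow> left_dead_end K \<Longrightarrow> K \<approx> K + G \<Longrightarrow> G = 0"
  using game_eq_cancel[of 0 G K] game_eq_zero_iff game_eq_sym by auto

section \<open>Factorisations\<close>

lemma atom_dead_end: "atom A \<Longrightarrow> left_dead_end A"
  by (simp add: atom_def)

lemma atom_nonzero: "atom A \<Longrightarrow> A \<noteq> 0"
  by (auto simp: atom_def)

lemma atomD:
  "atom A \<Longrightarrow> left_dead_end X \<Longrightarrow> left_dead_end Y \<Longrightarrow> A \<approx> X + Y \<Longrightarrow> X = 0 \<or> Y = 0"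
  using game_eq_zero_iff by (auto simp: atom_def)

section \<open>Primes and divisibility\<close>

lemma prime_dead_end_nonzero: "prime_dead_end P \<Longrightarrow> P \<noteq> 0"
  by (auto simp: prime_dead_end_def)

lemma prime_dead_end_dead_end: "prime_dead_end P \<Longrightarrow> left_dead_end P"
  by (simp add: prime_dead_end_def)

lemma divides_cong:
  "P \<approx> Q \<Longrightarrow> X \<approx> Y \<Longrightarrow> divides P X \<longleftrightarrow> divides Q Y"
  unfolding divides_def by (meson game_eq_add_right game_eq_sym game_eq_trans)

lemma prime_dead_end_cong:
  assumes "prime_dead_end P" "P \<approx> Q" "left_dead_end Q"
  shows "prime_dead_end Q"
proof -
  have "divides Q X \<longleftrightarrow> divides P X" for X
    using divides_cong[OF assms(2) game_eq_refl] by simp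
  moreover have "\<not> Q \<approx> 0"
    using assms(1,2) game_eq_trans unfolding prime_dead_end_def by blast
  ultimately show ?thesis
    using assms(1,3) by (simp add: prime_dead_end_def)
qed

text \<open>An atom splits only trivially and \<open>P\<close> is nonzero, so the cofactor must be
  \<open>0\<close>.\<close>

lemma prime_divides_atom:
  assumes "prime_dead_end P" "atom A" "divides P A"
  shows "P \<approx> A"
proof -
  obtain Y where Y: "left_dead_end Y" "A \<approx> P + Y"
    using assms(3) divides_def by blast
  then have "Y = 0"
    using atomD assms prime_dead_end_dead_end prime_dead_end_nonzero by blast
  then show ?thesis
    using Y(2) game_eq_sym by simp
qed

lemma prime_divides_sum_mset:
  assumes "prime_dead_end P" "\<And>A. A \<in># N \<Longrightarrow> left_dead_end A" "divides P (\<Sum>\<^sub># N)"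
  shows "\<exists>A\<in>#N. divides P A"
  using assms(2,3)
proof (induction N)
  case empty
  then obtain Y where "left_dead_end Y" "P + Y \<approx> 0"
    using divides_def game_eq_sym by auto
  then show ?case
    using assms(1) game_eq_add_zero prime_dead_end_dead_end prime_dead_end_nonzero by blast
next
  case (add A N)
  then have "divides P A \<or> divides P (\<Sum>\<^sub># N)"
    using assms(1) left_dead_end_sum_mset[of N] by (simp add: prime_dead_end_def)
  then show ?case
    using add by auto
qed

lemma factorisationD:
  assumes "factorisation M G"
  shows "\<And>A. A \<in># M \<Longrightarrow> atom A" "G \<approx> \<Sum>\<^sub># M" "left_dead_end (\<Sum>\<^sub># M)"
  using assms atom_dead_end left_dead_end_sum_mset by (auto simp: factorisation_def)

lemma factorisation_cong: "G \<approx> H \<Longrightarrow> factorisation M G \<longleftrightarrow> factorisation M H"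
  unfolding factorisation_def by (meson game_eq_sym game_eq_trans)

lemma factorisation_add:
  "factorisation M G \<Longrightarrow> factorisation N H \<Longrightarrow> factorisation (M + N) (G + H)"
  by (auto simp: factorisation_def game_eq_add)

lemma factorisation_sum_mset: "(\<And>A. A \<in># M \<Longrightarrow> atom A) \<Longrightarrow> factorisation M (\<Sum>\<^sub># M)"
  by (simp add: factorisation_def)

lemma factorisation_zero:
  assumes "factorisation M 0"
  shows "M = {#}"
proof (cases M)
  case (add A N)
  then have "A + \<Sum>\<^sub># N \<approx> 0" "atom A" "left_dead_end (\<Sum>\<^sub># N)"
    using assms atom_dead_end left_dead_end_sum_mset game_eq_sym by (auto simp: factorisation_def)
  then show ?thesis
    using game_eq_add_zero atom_dead_end atom_nonzero by blast
qed

text \<open>In a nontrivial splitting both summands have positive run lengths adding up to that of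
  \<open>G\<close>, so splitting terminates.\<close>

lemma factorisation_exists:
  "left_dead_end G \<Longrightarrow> \<exists>M. factorisation M G"
proof (induction "run_length G" arbitrary: G rule: less_induct)
  case less
  consider "G = 0" | "atom G"
    | X Y where "left_dead_end X" "left_dead_end Y" "G \<approx> X + Y" "X \<noteq> 0" "Y \<noteq> 0"
    using less.prems game_eq_zero_iff unfolding atom_def by metis
  then show ?case
  proof cases
    case 1
    then have "factorisation {#} G"
      by (simp add: factorisation_def)
    then show ?thesis ..
  next
    case 2
    then have "factorisation {#G#} G"
      by (simp add: factorisation_def)
    then show ?thesis ..
  next
    case 3
    then have "run_length G = run_length X + run_length Y"
      using run_length_game_eq run_length_add left_dead_end_add less.prems by metis
    then obtain M N where "factorisation M X" "factorisation N Y"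
      using 3 less.hyps[of X] less.hyps[of Y] run_length_eq_0_iff by fastforce
    then show ?thesis
      using 3 factorisation_add factorisation_cong by blast
  qed
qed

lemma uniquely_factorisableD:
  "uniquely_factorisable G \<Longrightarrow> factorisation M G \<Longrightarrow> factorisation N G \<Longrightarrow> rel_mset game_eq M N"
  by (simp add: uniquely_factorisable_def)

lemma uniquely_factorisable_cong:
  "G \<approx> H \<Longrightarrow> uniquely_factorisable G \<longleftrightarrow> uniquely_factorisable H"
  by (simp add: uniquely_factorisable_def factorisation_cong)

section \<open>Comparing factorisations and removing primes\<close>

lemma rel_mset_game_eq_sym: "rel_mset game_eq M N \<Longrightarrow> rel_mset game_eq N M"
  using multiset.rel_flip[of game_eq N M] game_eq_sym
  by (metis (no_types, lifting) conversep_iff multiset.rel_mono_strong)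

lemma rel_mset_game_eq_trans:
  assumes "rel_mset game_eq L M" "rel_mset game_eq M N"
  shows "rel_mset game_eq L N"
proof -
  have "rel_mset (game_eq OO game_eq) L N"
    unfolding multiset.rel_compp using assms by blast
  then show ?thesis
    by (rule multiset.rel_mono_strong) (use game_eq_trans in blast)
qed

lemma rel_mset_game_eq_union:
  "rel_mset game_eq L M \<Longrightarrow> rel_mset game_eq K N \<Longrightarrow> rel_mset game_eq (L + K) (M + N)"
  by (induction L M rule: rel_mset_induct) (auto intro: rel_mset_Plus)

lemma rel_mset_member:
  assumes "rel_mset R M N" "y \<in># N"
  shows "\<exists>x\<in>#M. R x y"
  using assms by (induction M N rule: rel_mset_induct) auto

text \<open>Euclid's argument: a prime \<open>P\<close> of \<open>M\<close> divides some atom of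
  \<open>N\<close>, hence equals it; both are removed by cancellation. The remainder
  \<open>Z\<close> may be any Left dead end.\<close>

lemma factorisation_split_primes:
  assumes "\<forall>P\<in>#M. prime_dead_end P" "left_dead_end Z" "factorisation N (\<Sum>\<^sub># M + Z)"
  shows "\<exists>N1 N2. N = N1 + N2 \<and> rel_mset game_eq M N1 \<and> factorisation N2 Z"
  using assms(1,3)
proof (induction M arbitrary: N)
  case empty
  then show ?case
    by (intro exI[of _ "{#}"] exI[of _ N]) (simp add: rel_mset_Zero)
next
  case (add P M)
  have P: "prime_dead_end P" and M: "\<forall>P\<in>#M. prime_dead_end P"
    using add.prems by auto
  have rest: "left_dead_end (\<Sum>\<^sub># M + Z)"
    using M assms(2) prime_dead_end_dead_end
    by (intro left_dead_end_add left_dead_end_sum_mset) auto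
  note N = factorisationD[OF add.prems(2)]
  have "divides P (\<Sum>\<^sub># N)"
    unfolding divides_def using rest N(2) game_eq_sym by (auto simp: add.assoc)
  then obtain B where B: "B \<in># N" "divides P B"
    using prime_divides_sum_mset P N(1) atom_dead_end by blast
  then have "P \<approx> B"
    using prime_divides_atom P N(1) by blast
  obtain N' where N': "N = add_mset B N'"
    using B(1) by (rule mset_add)
  \<comment> \<open>Trading \<open>B\<close> for \<open>P\<close> gives both sides literally the
    same summand, ready to be cancelled.\<close>
  have "P + \<Sum>\<^sub># N' \<approx> B + \<Sum>\<^sub># N'"
    using \<open>P \<approx> B\<close> game_eq_add_right by blast
  also have "B + \<Sum>\<^sub># N' \<approx> P + (\<Sum>\<^sub># M + Z)"
    using N(2) N' game_eq_sym by (simp add: add.assoc)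
  finally have "\<Sum>\<^sub># M + Z \<approx> \<Sum>\<^sub># N'"
    using game_eq_cancel[OF _ rest prime_dead_end_dead_end[OF P]] N' N(1) atom_dead_end
      left_dead_end_sum_mset[of N'] game_eq_sym by simp
  then have "factorisation N' (\<Sum>\<^sub># M + Z)"
    using N(1) N' by (simp add: factorisation_def)
  then obtain N1 N2 where "N' = N1 + N2" "rel_mset game_eq M N1" "factorisation N2 Z"
    using add.IH M by blast
  then show ?case
    using N' \<open>P \<approx> B\<close>
    by (intro exI[of _ "add_mset B N1"] exI[of _ N2]) (simp add: rel_mset_Plus)
qed

text \<open>Any two factorisations each contain a block matching \<open>M\<close>; what is left of
  them are two factorisations of \<open>Z\<close>.\<close>

lemma uniquely_factorisable_add_primes:
  assumes "\<forall>P\<in>#M. prime_dead_end P" "left_dead_end Z" "uniquely_factorisable Z"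
  shows "uniquely_factorisable (\<Sum>\<^sub># M + Z)"
  unfolding uniquely_factorisable_def
proof (intro conjI allI impI)
  show "\<exists>N. factorisation N (\<Sum>\<^sub># M + Z)"
    using assms(1,2) prime_dead_end_dead_end
    by (intro factorisation_exists left_dead_end_add left_dead_end_sum_mset) auto
  fix N N' assume N: "factorisation N (\<Sum>\<^sub># M + Z)" "factorisation N' (\<Sum>\<^sub># M + Z)"
  obtain N1 N2 where 1: "N = N1 + N2" "rel_mset game_eq M N1" "factorisation N2 Z"
    using factorisation_split_primes[OF assms(1,2) N(1)] by blast
  obtain N1' N2' where 2: "N' = N1' + N2'" "rel_mset game_eq M N1'" "factorisation N2' Z"
    using factorisation_split_primes[OF assms(1,2) N(2)] by blast
  have "rel_mset game_eq N1 N1'"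
    using 1(2) 2(2) rel_mset_game_eq_sym rel_mset_game_eq_trans by blast
  moreover have "rel_mset game_eq N2 N2'"
    using assms(3) 1(3) 2(3) by (rule uniquely_factorisableD)
  ultimately show "rel_mset game_eq N N'"
    using 1(1) 2(1) by (simp add: rel_mset_game_eq_union)
qed

section \<open>Good options\<close>

lemma right_opts_sum_mset:
  assumes "J |\<in>| right_opts (\<Sum>\<^sub># M)"
  shows "\<exists>A N A'. M = add_mset A N \<and> A' |\<in>| right_opts A \<and> J = A' + \<Sum>\<^sub># N"
  using assms
proof (induction M arbitrary: J)
  case empty
  then show ?case
    by simp
next
  case (add B M)
  then consider B' where "B' |\<in>| right_opts B" "J = B' + \<Sum>\<^sub># M"
    | J' where "J' |\<in>| right_opts (\<Sum>\<^sub># M)" "J = B + J'"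
    by (auto simp: right_opts_plus)
  then show ?case
  proof cases
    case 1
    then show ?thesis by blast
  next
    case 2
    then obtain A N A' where "M = add_mset A N" "A' |\<in>| right_opts A" "J' = A' + \<Sum>\<^sub># N"
      using add.IH by blast
    then have "add_mset B M = add_mset A (add_mset B N)" "J = A' + \<Sum>\<^sub># (add_mset B N)"
      using 2 by (simp_all add: add.left_commute)
    then show ?thesis
      using \<open>A' |\<in>| right_opts A\<close> by blast
  qed
qed

lemma game_gt_iff: "game_gt G H \<longleftrightarrow> game_ge G H \<and> \<not> game_ge H G"
  by (auto simp: game_gt_def game_eq_def)

text \<open>Going to \<open>H\<close> and back: an option of \<open>H\<close> below
  \<open>G'\<close> has an option of \<open>G\<close> below it, which by goodness is not strictly
  below \<open>G'\<close>. So every option of \<open>H\<close> below \<open>G'\<close> equals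
  \<open>G'\<close>, and one exists.\<close>

lemma good_option_cong:
  assumes "left_dead_end G" "left_dead_end H" "G \<approx> H" "good_option G' G"
  shows "\<exists>H'. good_option H' H \<and> G' \<approx> H'"
proof -
  have GH: "game_ge G H" "game_ge H G"
    using assms(3) by (auto simp: game_eq_def)
  have G': "G' |\<in>| right_opts G"
    and good: "\<And>K. K |\<in>| right_opts G \<Longrightarrow> game_ge G' K \<Longrightarrow> game_ge K G'"
    using assms(4) by (auto simp: good_option_def game_gt_iff)
  obtain H' where H': "H' |\<in>| right_opts H" "game_ge G' H'"
    using game_ge_option assms(1,2) GH(1) G' by blast
  have below: "game_ge J G'" if J: "J |\<in>| right_opts H" "game_ge G' J" for J
  proof -
    obtain K where "K |\<in>| right_opts G" "game_ge J K"
      using game_ge_option assms(1,2) GH(2) J(1) by blast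
    then show ?thesis
      using J(2) good game_ge_trans by blast
  qed
  have "good_option H' H"
    unfolding good_option_def game_gt_iff
    using H' below game_ge_trans by blast
  then show ?thesis
    using H' below by (auto simp: game_eq_def)
qed

text \<open>A strictly smaller option of \<open>G\<close> stays strictly smaller after adding
  \<open>K\<close>, by cancellation.\<close>

lemma good_option_add:
  assumes "left_dead_end G" "left_dead_end K" "G' |\<in>| right_opts G"
    "good_option (G' + K) (G + K)"
  shows "good_option G' G"
  unfolding good_option_def
proof (intro conjI notI)
  show "G' |\<in>| right_opts G"
    by fact
  assume "\<exists>G''|\<in>|right_opts G. game_gt G' G''"
  then obtain G'' where G'': "G'' |\<in>| right_opts G" "game_gt G' G''"
    by blast
  then have "game_gt (G' + K) (G'' + K)"
    using assms(1-3) game_ge_add_right game_ge_cancel left_dead_end_option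
    unfolding game_gt_iff by metis
  moreover have "G'' + K |\<in>| right_opts (G + K)"
    using G'' by (simp add: right_opts_plus)
  ultimately show False
    using assms(4) by (auto simp: good_option_def)
qed

section \<open>Multiples of a single game\<close>

lemma right_opts_copies:
  "J |\<in>| right_opts (copies (Suc n) A) \<Longrightarrow> \<exists>A'|\<in>|right_opts A. J = A' + copies n A"
proof (induction n arbitrary: J)
  case 0
  then show ?case
    by (auto simp: right_opts_plus)
next
  case (Suc n)
  then consider A' where "A' |\<in>| right_opts A" "J = A' + copies (Suc n) A"
    | J' where "J' |\<in>| right_opts (copies (Suc n) A)" "J = A + J'"
    by (auto simp: right_opts_plus[of A "copies (Suc n) A"] copies.simps(2)[of "Suc n"]
        simp del: copies.simps)
  then show ?case
  proof cases
    case 1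
    then show ?thesis by blast
  next
    case 2
    then show ?thesis
      using Suc.IH by (force simp: add.left_commute)
  qed
qed

text \<open>All options of the multiple share the summand \<open>copies n A\<close>, so cancellation
  reduces their comparison to that of options of \<open>A\<close>.\<close>

lemma good_option_copies:
  assumes "left_dead_end A" "left_dead_end (copies n A)" "good_option A' A"
  shows "good_option (A' + copies n A) (copies (Suc n) A)"
  unfolding good_option_def game_gt_iff
proof (intro conjI notI)
  show "A' + copies n A |\<in>| right_opts (copies (Suc n) A)"
    using assms(3) by (simp add: good_option_def right_opts_plus)
  assume "\<exists>J|\<in>|right_opts (copies (Suc n) A).
    game_ge (A' + copies n A) J \<and> \<not> game_ge J (A' + copies n A)"
  then obtain B where B: "B |\<in>| right_opts A" "game_ge (A' + copies n A) (B + copies n A)"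
      "\<not> game_ge (B + copies n A) (A' + copies n A)"
    using right_opts_copies by metis
  then have "game_gt A' B"
    using assms left_dead_end_option game_ge_cancel game_ge_add_right
    unfolding game_gt_iff good_option_def by metis
  then show False
    using assms(3) B(1) by (auto simp: good_option_def)
qed

lemma copies_eq_sum_mset: "copies n A = \<Sum>\<^sub># (replicate_mset n A)"
  by (induction n) auto

lemma copies_add: "copies (m + n) A = copies m A + copies n A"
  by (induction m) (auto simp: add.assoc)

lemma left_dead_end_copies: "left_dead_end A \<Longrightarrow> left_dead_end (copies n A)"
  by (induction n) (auto intro: left_dead_end_add)

lemma copies_cong: "G \<approx> H \<Longrightarrow> copies n G \<approx> copies n H"
  by (induction n) (auto intro: game_eq_add)

lemma copies_plus: "copies n (G + H) = copies n G + copies n H"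
  by (induction n) (auto simp: ac_simps)

lemma copies_sum_mset: "copies n (\<Sum>\<^sub># M) = \<Sum>\<^sub># (repeat_mset n M)"
  by (induction n) auto

lemma sum_mset_game_eq_copies:
  assumes "\<And>B. B \<in># N \<Longrightarrow> A \<approx> B"
  shows "copies (size N) A \<approx> \<Sum>\<^sub># N \<and> rel_mset game_eq (replicate_mset (size N) A) N"
  using assms by (induction N) (auto intro: game_eq_add rel_mset_Zero rel_mset_Plus)

lemma uniquely_factorisable_copies_atom:
  assumes A: "atom A" and good: "good_option A' A"
    and M: "factorisation M A'" "\<forall>P\<in>#M. prime_dead_end P"
  shows "uniquely_factorisable (copies n A)"
proof (induction n)
  case 0
  show ?case
    unfolding uniquely_factorisable_def
    using factorisation_exists[OF left_dead_end_0]
    by (auto simp: rel_mset_Zero dest!: factorisation_zero)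
next
  case (Suc n)
  have dead: "left_dead_end A" "left_dead_end (copies k A)" for k
    using A atom_dead_end left_dead_end_copies by blast+
  \<comment> \<open>Matching each factorisation with the standard one suffices: any two are then
    related through it.\<close>
  have main: "rel_mset game_eq (replicate_mset (Suc n) A) N"
    if N: "factorisation N (copies (Suc n) A)" for N
  proof -
    note N_D = factorisationD[OF N]
    \<comment> \<open>The good option of the multiple reappears, up to equality, among the options
      of the sum over \<open>N\<close>, where it arises from a move in one atom \<open>B\<close>
      only.\<close>
    obtain J where J: "good_option J (\<Sum>\<^sub># N)" "A' + copies n A \<approx> J"
      using good_option_cong[OF dead(2) N_D(3) N_D(2)] good_option_copies dead good by blast
    then obtain B N0 B' where B: "N = add_mset B N0" "B' |\<in>| right_opts B" "J = B' + \<Sum>\<^sub># N0"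
      using right_opts_sum_mset good_option_def by metis
    have atoms: "atom B" "\<And>C. C \<in># N0 \<Longrightarrow> atom C"
      using N_D(1) B(1) by auto
    then have "left_dead_end B'"
      using B(2) atom_dead_end left_dead_end_option by blast
    then obtain N1 where "factorisation N1 B'"
      using factorisation_exists by blast
    then have fact1: "factorisation (N1 + N0) J"
      using B(3) atoms factorisation_add factorisation_sum_mset by metis
    have "factorisation (replicate_mset n A) (copies n A)"
      using A by (auto simp: factorisation_def copies_eq_sum_mset split: if_splits)
    then have fact2: "factorisation (M + replicate_mset n A) J"
      using M(1) J(2) factorisation_add factorisation_cong by blast
    have "uniquely_factorisable (\<Sum>\<^sub># M + copies n A)"
      using uniquely_factorisable_add_primes M(2) dead Suc.IH by blast
    moreover have "\<Sum>\<^sub># M + copies n A \<approx> J"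
      using factorisationD(2)[OF M(1)] J(2) game_eq_add_right game_eq_sym game_eq_trans by meson
    ultimately have rel: "rel_mset game_eq (M + replicate_mset n A) (N1 + N0)"
      using fact1 fact2 uniquely_factorisable_cong uniquely_factorisableD by blast
    \<comment> \<open>The atoms in \<open>N0\<close> were untouched by the move, so they occur in a
      factorisation of \<open>J\<close>, and uniqueness there makes each equal to \<open>A\<close>
      or to a prime of \<open>M\<close>.\<close>
    have "A \<approx> C" if C: "C \<in># N0" for C
    proof -
      obtain D where D: "D \<in># M + replicate_mset n A" "D \<approx> C"
        using rel_mset_member[OF rel] C by auto
      show ?thesis
      proof (cases "D \<in># M")
        case False
        then show ?thesis
          using D by (auto split: if_splits)
      next
        case True
        then have C_prime: "prime_dead_end C"
          using M(2) D(2) atoms(2) C atom_dead_end prime_dead_end_cong by blast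
        have "left_dead_end (\<Sum>\<^sub># (N - {#C#}))"
          using N_D(1) atom_dead_end by (blast intro: left_dead_end_sum_mset dest: in_diffD)
        moreover have "\<Sum>\<^sub># N = C + \<Sum>\<^sub># (N - {#C#})"
          using C B(1) by (intro sum_mset.remove) simp
        ultimately have "divides C (copies (Suc n) A)"
          using N_D(2) by (auto simp: divides_def)
        then have "divides C (\<Sum>\<^sub># (replicate_mset (Suc n) A))"
          by (simp only: copies_eq_sum_mset)
        then have "\<exists>E\<in>#replicate_mset (Suc n) A. divides C E"
          using dead(1) by (intro prime_divides_sum_mset[OF C_prime]) (auto split: if_splits)
        then have "divides C A"
          by (auto split: if_splits)
        then show ?thesis
          using C_prime A prime_divides_atom game_eq_sym by blast
      qed
    qed
    then have N0: "copies (size N0) A \<approx> \<Sum>\<^sub># N0"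
        "rel_mset game_eq (replicate_mset (size N0) A) N0"
      using sum_mset_game_eq_copies by blast+
    have "copies (Suc n) A \<approx> \<Sum>\<^sub># N0 + B"
      using N_D(2) B(1) by (simp add: add.commute)
    also have "\<Sum>\<^sub># N0 + B \<approx> copies (size N0) A + B"
      using N0(1) game_eq_add_right game_eq_sym by blast
    finally have eq: "copies (Suc n) A \<approx> copies (size N0) A + B" .
    \<comment> \<open>The size of \<open>N0\<close> is not yet known to be \<open>n\<close>. If it
      is at most \<open>n\<close>, cancelling leaves \<open>B\<close> equal to a positive multiple
      of \<open>A\<close>, and \<open>B\<close> being an atom forces the factor 1. Otherwise
      cancelling leaves a sum containing \<open>B\<close> that equals \<open>0\<close>, which is
      absurd.\<close>
    show ?thesis
    proof (cases "size N0 \<le> n")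
      case True
      then obtain m where m: "Suc n = size N0 + Suc m"
        using le_Suc_ex by fastforce
      have "copies (size N0) A + copies (Suc m) A \<approx> copies (size N0) A + B"
        using eq m by (simp only: copies_add)
      then have "copies (Suc m) A \<approx> B"
        using game_eq_cancel[OF dead(2) _ dead(2)] atoms(1) atom_dead_end by blast
      then have "B \<approx> A + copies m A"
        using game_eq_sym by simp
      moreover from this have "copies m A = 0"
        using atomD[OF atoms(1)] dead A atom_nonzero by blast
      then have "m = 0"
        using game_eq_add_zero[of A "copies (m - 1) A"] A atom_nonzero dead
        by (cases m) auto
      ultimately have "A \<approx> B"
        using game_eq_sym by simp
      then show ?thesis
        using N0(2) B(1) m \<open>m = 0\<close> rel_mset_Plus by fastforce
    next
      case False
      then obtain m where m: "size N0 = Suc n + m"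
        using le_Suc_ex not_less_eq_eq by metis
      have "copies (Suc n) A \<approx> copies (Suc n) A + (copies m A + B)"
        using eq m by (simp only: copies_add add.assoc)
      then have "copies m A + B = 0"
        using game_eq_cancel_self[OF _ dead(2)] dead(2) atoms(1) atom_dead_end left_dead_end_add
        by blast
      then have "B = 0"
        using game_eq_add_zero[of B "copies m A"] dead atoms(1) atom_dead_end
        by (simp add: add.commute)
      then show ?thesis
        using atoms(1) atom_nonzero by blast
    qed
  qed
  then show ?case
    unfolding uniquely_factorisable_def
    using factorisation_exists[OF dead(2)] rel_mset_game_eq_sym rel_mset_game_eq_trans by blast
qed

section \<open>From an atom to an arbitrary Left dead end\<close>

theorem mainTheorem20:
  fixes G G' :: game and n :: nat
  assumes "left_dead_end G"
    and "good_option G' G"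
    and "prime_factorisable G'"
  shows "uniquely_factorisable (copies n G)"
proof -
  obtain M where M: "factorisation M G'" "\<forall>P\<in>#M. prime_dead_end P"
    using assms(3) prime_factorisable_def by blast
  obtain K where K: "factorisation K G"
    using factorisation_exists assms(1) by blast
  note K_D = factorisationD[OF K]
  \<comment> \<open>The given good option is transported to a sum of atoms, where it is a move in a
    single atom \<open>A\<close>; the atoms in \<open>K0\<close> survive in it.\<close>
  obtain J where J: "good_option J (\<Sum>\<^sub># K)" "G' \<approx> J"
    using good_option_cong[OF assms(1) K_D(3) K_D(2) assms(2)] by blast
  then obtain A K0 A' where A: "K = add_mset A K0" "A' |\<in>| right_opts A" "J = A' + \<Sum>\<^sub># K0"
    using right_opts_sum_mset good_option_def by metis
  have atoms: "atom A" "\<And>C. C \<in># K0 \<Longrightarrow> atom C"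
    using K_D(1) A(1) by auto
  have dead: "left_dead_end A" "left_dead_end A'" "left_dead_end (\<Sum>\<^sub># K0)"
    using atoms A(2) atom_dead_end left_dead_end_option left_dead_end_sum_mset by blast+
  have good: "good_option A' A"
    using good_option_add[OF dead(1,3) A(2)] J(1) A(1,3) by simp
  obtain K1 where K1: "factorisation K1 A'"
    using factorisation_exists dead(2) by blast
  have "factorisation (K1 + K0) J"
    using A(3) K1 atoms(2) factorisation_add factorisation_sum_mset by metis
  moreover have "\<Sum>\<^sub># M \<approx> J"
    using factorisationD(2)[OF M(1)] J(2) game_eq_sym game_eq_trans by blast
  \<comment> \<open>With remainder \<open>0\<close>, splitting off the primes of \<open>M\<close>
    leaves nothing, so all of \<open>K1 + K0\<close> is matched with primes.\<close>
  ultimately have "factorisation (K1 + K0) (\<Sum>\<^sub># M + 0)"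
    using factorisation_cong by simp
  then obtain N1 N2 where "K1 + K0 = N1 + N2" "rel_mset game_eq M N1" "factorisation N2 0"
    using factorisation_split_primes[OF M(2) left_dead_end_0] by blast
  then have rel: "rel_mset game_eq M (K1 + K0)"
    using factorisation_zero by fastforce
  have prime: "prime_dead_end C" if C: "C \<in># K1 + K0" for C
  proof -
    have "atom C"
      using C atoms(2) factorisationD(1)[OF K1] by auto
    then show ?thesis
      using rel_mset_member[OF rel C] M(2) prime_dead_end_cong atom_dead_end by blast
  qed
  have "uniquely_factorisable (copies n A)"
    using uniquely_factorisable_copies_atom[OF atoms(1) good K1] prime by simp
  moreover have "\<forall>P\<in>#repeat_mset n K0. prime_dead_end P"
    using prime by (auto simp: count_greater_zero_iff[symmetric] simp del: count_greater_zero_iff)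
  \<comment> \<open>In \<open>copies n G\<close> everything except the copies of \<open>A\<close> is
    a sum of primes, which does not affect uniqueness.\<close>
  ultimately have "uniquely_factorisable (\<Sum>\<^sub># (repeat_mset n K0) + copies n A)"
    using uniquely_factorisable_add_primes left_dead_end_copies dead(1) by blast
  moreover have "copies n G \<approx> \<Sum>\<^sub># (repeat_mset n K0) + copies n A"
    using copies_cong[OF K_D(2), of n] A(1)
    by (simp add: copies_plus copies_sum_mset add.commute)
  ultimately show ?thesis
    using uniquely_factorisable_cong by blast
qed

end
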